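(* Let $1\le r<d$, $D>0$, $m\ge1$, $\mathcal B=\{B\in\mathbb R^{d\times r}:\|B\|_2\le D\}$ and $\mathbf P_{\mathcal X}(\mathcal B)=\{\text{density of }N(0,BB^T+I_d):B\in\mathcal B\}$. Then $$\log N_{[\,]}(\mathbf P_{\mathcal X}(\mathcal B),1/m)\le 4dr\log\big(24mdr(D^2+1)\big).$$
   Context: Bracketing number: for a family $\mathbf P$ of densities on $\mathbb R^d$ and $\epsilon>0$, $N_{[\,]}(\mathbf P,\epsilon)$ is the minimal cardinality of a finite set $\mathbf N$ of nonnegative functions such that for each $p\in\mathbf P$ there is $\bar p\in\mathbf N$ with $\bar p\ge p$ pointwise and $\int(\bar p-p)\,dx\le\epsilon$. *)

theory Defs
  imports "HOL-Analysis.Analysis"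
begin

text \<open>Density of the centred Gaussian N(0, S) on R^d (S symmetric positive definite):
  (2 pi)^(-d/2) det(S)^(-1/2) exp(- x^T S^(-1) x / 2).\<close>
definition gauss_density :: "real^'d^'d \<Rightarrow> real^'d \<Rightarrow> real" where
  "gauss_density S x =
     (2 * pi) powr (- real CARD('d) / 2) * (det S) powr (- 1 / 2)
       * exp (- (x \<bullet> (matrix_inv S *v x)) / 2)"

text \<open>The family of densities of N(0, B B^T + I_d), B ranging over a set of d x r matrices.\<close>
definition gauss_family :: "(real^'r^'d) set \<Rightarrow> (real^'d \<Rightarrow> real) set" where
  "gauss_family BB = {gauss_density (B ** transpose B + mat 1) | B. B \<in> BB}"

text \<open>N is a finite bracketing set at scale eps for the family P: nonnegative (measurable)
  functions, each p in P lies below some element with L1 excess at most eps.\<close>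
definition is_bracketing :: "('a::euclidean_space \<Rightarrow> real) set \<Rightarrow> real \<Rightarrow> ('a \<Rightarrow> real) set \<Rightarrow> bool" where
  "is_bracketing P eps N \<longleftrightarrow> finite N \<and>
     (\<forall>q\<in>N. q \<in> borel_measurable lborel \<and> (\<forall>x. 0 \<le> q x)) \<and>
     (\<forall>p\<in>P. \<exists>q\<in>N. (\<forall>x. p x \<le> q x) \<and>
        (\<integral>\<^sup>+ x. ennreal (q x - p x) \<partial>lborel) \<le> ennreal eps)"

definition bracketing_number :: "('a::euclidean_space \<Rightarrow> real) set \<Rightarrow> real \<Rightarrow> enat" where
  "bracketing_number P eps = Inf ((\<lambda>N. enat (card N)) ` {N. is_bracketing P eps N})"

end

theory Submission
  imports Defs "HOL-Probability.Distributions"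
begin

text \<open>
  Write \<open>S(B, c) = B B\<^sup>T + c I\<close>. Round the entries of \<open>B\<close> down to a grid point \<open>B\<^sub>0\<close> of
  small mesh; then \<open>\<parallel>(B - B\<^sub>0)\<^sup>T\<parallel> \<le> \<delta>\<close>, and in the Loewner order
  \<open>S(B, 1) \<le> S(B\<^sub>0, 1 + \<theta>) \<le> (1 + 2\<theta>) S(B, 1)\<close>. Inversion reverses this order and the
  determinant respects it, so the densities \<open>p\<close> of \<open>N(0, S(B, 1))\<close> and \<open>q\<close> of
  \<open>N(0, S(B\<^sub>0, 1 + \<theta>))\<close> satisfy \<open>p \<le> (1 + 2\<theta>)\<^bsup>d/2\<^esup> q\<close> pointwise. As \<open>p\<close> and \<open>q\<close> are
  probability densities, this bracket has \<open>L\<^sup>1\<close> excess \<open>(1 + 2\<theta>)\<^bsup>d/2\<^esup> - 1 \<le> 1/m\<close> for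
  \<open>\<theta> = 1/(4md)\<close>, and counting grid points gives the entropy bound.
\<close>

section \<open>Linear change of variables\<close>

lemma det_matrix_shear:
  fixes m n :: "'n::finite"
  assumes "m \<noteq> n"
  shows "det (matrix (\<lambda>v::real^'n. \<chi> i. if i = m then v $ m + v $ n else v $ i)) = 1"
proof -
  have "matrix (\<lambda>v::real^'n. \<chi> i. if i = m then v $ m + v $ n else v $ i)
      = (\<chi> k. if k = m then row m (mat 1) + 1 *s row n (mat 1) else row k (mat 1 :: real^'n^'n))"
    using assms by (auto simp: matrix_def vec_eq_iff row_def mat_def axis_def)
  then show ?thesis
    using det_row_operation[OF assms, of "mat 1 :: real^'n^'n" 1] by simp
qed

lemma measure_permute_coordinates_cbox:
  fixes a b :: "real^'n::finite"
  assumes p: "p permutes UNIV"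
  shows "measure lebesgue ((\<lambda>x. \<chi> i. x $ p i) ` cbox a b) = measure lebesgue (cbox a b)"
proof -
  let ?P = "\<lambda>x::real^'n. \<chi> i. x $ p i"
  have "?P ` cbox a b = cbox (?P a) (?P b)"
  proof (intro equalityI subsetI)
    fix y assume "y \<in> cbox (?P a) (?P b)"
    moreover have "p (inv p i) = i" and "inv p (p i) = i" for i
      using p by (simp_all add: permutes_inverses)
    ultimately have "(\<chi> i. y $ inv p i) \<in> cbox a b" and "y = ?P (\<chi> i. y $ inv p i)"
      by (auto simp: mem_box_cart vec_eq_iff) (metis)+
    then show "y \<in> ?P ` cbox a b" by blast
  qed (auto simp: mem_box_cart)
  moreover have "(\<Prod>i\<in>UNIV. (?P b - ?P a) $ i) = (\<Prod>i\<in>UNIV. (b - a) $ i)"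
    using prod.permute[OF p, of "\<lambda>i. (b - a) $ i"] by (simp add: comp_def)
  ultimately show ?thesis
    by (simp add: content_cbox_if_cart) (auto simp: mem_box_cart)
qed

lemma measure_shear_cbox:
  fixes a b :: "real^'n::finite"
  assumes "m \<noteq> n"
  shows "measure lebesgue ((\<lambda>x. \<chi> i. if i = m then x $ m + x $ n else x $ i) ` cbox a b)
       = measure lebesgue (cbox a b)"
proof (cases "cbox a b = {}")
  case False
  let ?f = "\<lambda>x::real^'n. \<chi> i. if i = m then x $ m + x $ n else x $ i"
  have "linear ?f"
    by (rule linearI) (auto simp: vec_eq_iff algebra_simps)
  have ne: "cbox 0 (b - a) \<noteq> {}"
    using False by (simp add: interval_ne_empty_cart)
  have "cbox a b = (+) a ` cbox 0 (b - a)"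
    using cbox_translation[of a 0 "b - a"] by simp
  then have "?f ` cbox a b = (+) (?f a) ` ?f ` cbox 0 (b - a)"
    using linear_add[OF \<open>linear ?f\<close>] by (simp add: image_image)
  then have "measure lebesgue (?f ` cbox a b) = measure lebesgue (cbox 0 (b - a))"
    using measure_shear_interval[OF assms ne] by (simp add: measure_translation)
  also have "\<dots> = measure lebesgue (cbox a b)"
    using \<open>cbox a b = _\<close> by (simp add: measure_translation)
  finally show ?thesis .
qed simp

lemma det_matrix_stretch: "det (matrix (\<lambda>x::real^'n::finite. \<chi> i. c i * x $ i)) = prod c UNIV"
proof -
  have "matrix (\<lambda>x::real^'n. \<chi> i. c i * x $ i) = (\<chi> i j. if i = j then c i else 0)"
    by (simp add: matrix_def vec_eq_iff axis_def)
  then show ?thesis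
    by (simp add: det_diagonal)
qed

lemma abs_det_matrix_permute_coordinates:
  fixes p :: "'n::finite \<Rightarrow> 'n"
  assumes "p permutes UNIV"
  shows "\<bar>det (matrix (\<lambda>x::real^'n. \<chi> i. x $ p i))\<bar> = 1"
proof -
  have "matrix (\<lambda>x::real^'n. \<chi> i. x $ p i) = transpose (\<chi> i j. mat 1 $ i $ p j)"
    by (simp add: vec_eq_iff transpose_def axis_def mat_def matrix_def eq_commute)
  then show ?thesis
    by (simp add: det_permute_columns[OF assms] abs_mult flip: of_int_abs)
qed

lemma measure_linear_image_of_cboxes:
  fixes f :: "real^'n::finite \<Rightarrow> real^'n"
  assumes "linear f" "\<bar>det (matrix f)\<bar> = 1"
    and "\<And>a b. measure lebesgue (f ` cbox a b) = measure lebesgue (cbox a b)" and "S \<in> lmeasurable"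
  shows "f ` S \<in> lmeasurable \<and> measure lebesgue (f ` S) = \<bar>det (matrix f)\<bar> * measure lebesgue S"
  using measure_linear_sufficient[of f S 1] assms by simp

text \<open>The library version of this fact is stated for index types that are also well-ordered.\<close>

proposition measure_linear_image_cart:
  fixes f :: "real^'n::finite \<Rightarrow> real^'n"
  assumes "linear f" "S \<in> lmeasurable"
  shows "f ` S \<in> lmeasurable \<and> measure lebesgue (f ` S) = \<bar>det (matrix f)\<bar> * measure lebesgue S"
proof -
  let ?Q = "\<lambda>f. \<forall>S \<in> lmeasurable. f ` S \<in> lmeasurable
              \<and> measure lebesgue (f ` S) = \<bar>det (matrix f)\<bar> * measure lebesgue S"
  have "?Q f"
  proof (rule induct_linear_elementary[where P = ?Q, OF \<open>linear f\<close>])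
    fix f g :: "real^'n \<Rightarrow> real^'n"
    assume "linear f" "linear g" and f: "?Q f" and g: "?Q g"
    show "?Q (f \<circ> g)"
    proof
      fix S :: "(real^'n) set"
      assume "S \<in> lmeasurable"
      then have "g ` S \<in> lmeasurable"
        using g by blast
      then show "(f \<circ> g) ` S \<in> lmeasurable
          \<and> measure lebesgue ((f \<circ> g) ` S) = \<bar>det (matrix (f \<circ> g))\<bar> * measure lebesgue S"
        using f[rule_format, OF \<open>g ` S \<in> lmeasurable\<close>] g[rule_format, OF \<open>S \<in> lmeasurable\<close>]
          matrix_compose[OF \<open>linear g\<close> \<open>linear f\<close>]
        by (simp add: image_comp det_mul abs_mult)
    qed
  next
    fix f :: "real^'n \<Rightarrow> real^'n" and i
    assume "linear f" and "\<And>x. f x $ i = 0"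
    then have "\<not> inj f"
      by (metis linear_injective_imp_surjective one_neq_zero surjE vec_component)
    then have "det (matrix f) = 0" and "negligible (f ` S)" for S
      using det_nz_iff_inj[OF \<open>linear f\<close>] negligible_linear_singular_image[OF \<open>linear f\<close>]
      by blast+
    then show "?Q f"
      by (simp add: negligible_imp_measurable negligible_imp_measure0)
  next
    fix c :: "'n \<Rightarrow> real"
    show "?Q (\<lambda>x. \<chi> i. c i * x $ i)"
      by (simp add: measurable_stretch measure_stretch det_matrix_stretch)
  next
    fix m n :: 'n
    assume "m \<noteq> n"
    then show "?Q (\<lambda>x. \<chi> i. x $ Transposition.transpose m n i)"
      by (intro ballI measure_linear_image_of_cboxes measure_permute_coordinates_cbox
          abs_det_matrix_permute_coordinates permutes_swap_id)
        (auto intro: linearI simp: vec_eq_iff)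
  next
    fix m n :: 'n
    assume "m \<noteq> n"
    then show "?Q (\<lambda>x. \<chi> i. if i = m then x $ m + x $ n else x $ i)"
      by (intro ballI measure_linear_image_of_cboxes measure_shear_cbox)
        (auto intro: linearI simp: vec_eq_iff det_matrix_shear algebra_simps)
  qed
  with assms show ?thesis
    by blast
qed

lemma matrix_inv_right: "invertible A \<Longrightarrow> A ** matrix_inv A = mat 1"
  and matrix_inv_left: "invertible A \<Longrightarrow> matrix_inv A ** A = mat 1"
  for A :: "'a::semiring_1^'n^'n"
  unfolding invertible_def matrix_inv_def by (metis (mono_tags, lifting) someI_ex)+

lemma matrix_inv_vector:
  fixes A :: "'a::semiring_1^'n^'n"
  assumes "invertible A"
  shows "A *v (matrix_inv A *v x) = x" and "matrix_inv A *v (A *v x) = x"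
  by (simp_all add: matrix_vector_mul_assoc matrix_inv_right[OF assms] matrix_inv_left[OF assms])

lemma lborel_eq_density_distr_linear:
  fixes A :: "real^'n^'n"
  assumes "det A \<noteq> 0"
  shows "lborel = density (distr lborel borel ((*v) A)) (\<lambda>_. \<bar>det A\<bar>)"
proof (rule lborel_eqI)
  fix l u :: "real^'n"
  assume lu: "\<And>b. b \<in> Basis \<Longrightarrow> l \<bullet> b \<le> u \<bullet> b"
  have inv: "invertible A"
    using assms invertible_det_nz by blast
  let ?Ai = "matrix_inv A"
  have det_inv: "\<bar>det A\<bar> * \<bar>det ?Ai\<bar> = 1"
    using det_mul[of A ?Ai] by (simp add: matrix_inv_right[OF inv] abs_mult[symmetric])
  have meas: "(*v) A \<in> borel_measurable borel"
    by (intro borel_measurable_continuous_onI linear_continuous_on matrix_vector_mul_bounded_linear)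
  have "(*v) A -` box l u = (*v) ?Ai ` box l u"
    using matrix_inv_vector[OF inv] by (auto simp: image_iff) metis
  moreover have "(*v) A -` box l u \<in> sets lborel"
    using meas by (simp add: measurable_sets_borel)
  ultimately have "emeasure lborel ((*v) A -` box l u) = emeasure lebesgue ((*v) ?Ai ` box l u)"
    by (simp add: emeasure_completion)
  also have "\<dots> = \<bar>det ?Ai\<bar> * measure lebesgue (box l u)"
    using measure_linear_image_cart[of "(*v) ?Ai" "box l u"] by (simp add: emeasure_eq_measure2)
  also have "measure lebesgue (box l u) = (\<Prod>b\<in>Basis. (u - l) \<bullet> b)"
    using lu by (simp add: measure_lborel_box_eq)
  finally have "emeasure lborel ((*v) A -` box l u) = \<bar>det ?Ai\<bar> * (\<Prod>b\<in>Basis. (u - l) \<bullet> b)" .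
  moreover have "0 \<le> (\<Prod>b\<in>Basis. (u - l) \<bullet> b)"
    using lu by (auto simp: inner_diff_left intro!: prod_nonneg)
  ultimately show "emeasure (density (distr lborel borel ((*v) A)) (\<lambda>_. \<bar>det A\<bar>)) (box l u)
      = (\<Prod>b\<in>Basis. (u - l) \<bullet> b)"
    using det_inv \<open>0 \<le> (\<Prod>b\<in>Basis. _)\<close> meas
    by (simp add: emeasure_density nn_integral_cmult_indicator emeasure_distr
        ennreal_mult[symmetric] mult.assoc[symmetric])
qed simp

lemma nn_integral_lborel_linear:
  fixes A :: "real^'n^'n" and h :: "real^'n \<Rightarrow> ennreal"
  assumes "det A \<noteq> 0" and [measurable]: "h \<in> borel_measurable borel"
  shows "(\<integral>\<^sup>+x. h x \<partial>lborel) = \<bar>det A\<bar> * (\<integral>\<^sup>+y. h (A *v y) \<partial>lborel)"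
proof -
  have [measurable]: "(*v) A \<in> borel_measurable borel"
    by (intro borel_measurable_continuous_onI linear_continuous_on matrix_vector_mul_bounded_linear)
  have "(\<integral>\<^sup>+x. h x \<partial>lborel) = (\<integral>\<^sup>+x. \<bar>det A\<bar> * h x \<partial>distr lborel borel ((*v) A))"
    by (subst lborel_eq_density_distr_linear[OF assms(1)]) (simp add: nn_integral_density)
  also have "\<dots> = \<bar>det A\<bar> * (\<integral>\<^sup>+y. h (A *v y) \<partial>lborel)"
    by (simp add: nn_integral_distr nn_integral_cmult)
  finally show ?thesis .
qed

lemma inner_transpose_matrix_vector: "(transpose A *v x) \<bullet> y = x \<bullet> (A *v y)"
  for A :: "real^'n^'m"
  by (simp add: dot_lmul_matrix)

lemma matrix_vector_mult_mat: "mat c *v x = c *\<^sub>R x"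
  for x :: "real^'n"
  by (simp add: vec_eq_iff matrix_vector_mult_def mat_def if_distrib[of "\<lambda>a. a * _"] cong: if_cong)

lemma det_scaleR_cart: "det (c *\<^sub>R A) = c ^ CARD('n) * det A"
  for A :: "real^'n^'n"
proof -
  have "c *\<^sub>R A = (\<chi> i. c *s A $ i)"
    by (simp add: vec_eq_iff)
  then show ?thesis
    using det_rows_mul[of "\<lambda>_. c" "\<lambda>i. A $ i"] by simp
qed

section \<open>Positive definite matrices and Gaussian integrals\<close>

text \<open>Positive definiteness in factorised form; for symmetric matrices this is the usual notion.\<close>

definition pos_definite :: "real^'n^'n \<Rightarrow> bool" where
  "pos_definite S \<longleftrightarrow> (\<exists>L::real^'n^'n. invertible L \<and> S = transpose L ** L)"

lemma pos_definite_quadratic_form: "S = transpose L ** L \<Longrightarrow> y \<bullet> (S *v y) = (norm (L *v y))\<^sup>2"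
  for L :: "real^'n^'m"
  using inner_transpose_matrix_vector[of L "L *v y" y]
  by (simp add: power2_norm_eq_inner inner_commute flip: matrix_vector_mul_assoc)

lemma pos_definite_nonneg: "pos_definite S \<Longrightarrow> 0 \<le> y \<bullet> (S *v y)"
  unfolding pos_definite_def using pos_definite_quadratic_form by fastforce

lemma pos_definite_symmetric: "pos_definite S \<Longrightarrow> transpose S = S"
  unfolding pos_definite_def by (auto simp: matrix_transpose_mul)

lemma pos_definite_det_pos: "pos_definite S \<Longrightarrow> 0 < det S"
  unfolding pos_definite_def by (auto simp: det_mul invertible_det_nz) (metis not_real_square_gt_zero)

lemma pos_definite_invertible: "pos_definite S \<Longrightarrow> invertible S"
  using pos_definite_det_pos invertible_det_nz by force

lemma pos_definite_scaleR: "pos_definite S \<Longrightarrow> 0 < c \<Longrightarrow> pos_definite (c *\<^sub>R S)"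
  for S :: "real^'n^'n"
  unfolding pos_definite_def
proof (elim exE conjE)
  fix L :: "real^'n^'n"
  assume "invertible L" "S = transpose L ** L" "0 < c"
  then have "det (sqrt c *\<^sub>R L) \<noteq> 0"
    by (simp add: invertible_det_nz det_scaleR_cart)
  moreover have "c *\<^sub>R S = transpose (sqrt c *\<^sub>R L) ** (sqrt c *\<^sub>R L)"
    using \<open>S = _\<close> \<open>0 < c\<close> by (simp add: transpose_scalar scalar_matrix_assoc matrix_scalar_ac)
  ultimately have "invertible (sqrt c *\<^sub>R L) \<and> c *\<^sub>R S = transpose (sqrt c *\<^sub>R L) ** (sqrt c *\<^sub>R L)"
    by (simp add: invertible_det_nz)
  then show "\<exists>L::real^'n^'n. invertible L \<and> c *\<^sub>R S = transpose L ** L" ..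
qed

text \<open>The square root of a Gram matrix: an injective linear map into any Euclidean space is,
  up to an isometry, an invertible square matrix.\<close>

lemma pos_definite_gram:
  fixes \<phi> :: "real^'n \<Rightarrow> 'e::euclidean_space"
  assumes "linear \<phi>" "inj \<phi>" and S: "\<And>x y. x \<bullet> (S *v y) = \<phi> x \<bullet> \<phi> y"
  shows "pos_definite S"
proof -
  have "dim (range \<phi>) = dim (UNIV :: (real^'n) set)"
    using dim_image_eq[OF \<open>linear \<phi>\<close>, of UNIV] \<open>inj \<phi>\<close> by (simp add: inj_on_def)
  then obtain f :: "'e \<Rightarrow> real^'n" where "linear f" and f_norm: "\<And>x. norm (f (\<phi> x)) = norm (\<phi> x)"
    using isometry_subspaces[OF linear_subspace_image[OF \<open>linear \<phi>\<close> subspace_UNIV] subspace_UNIV]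
    by (metis rangeI)
  define L where "L = matrix (f \<circ> \<phi>)"
  have "linear (f \<circ> \<phi>)"
    using \<open>linear f\<close> \<open>linear \<phi>\<close> by (rule linear_compose[rotated])
  then have L: "L *v x = f (\<phi> x)" for x
    by (simp add: L_def matrix_works)
  have inner_L: "(L *v x) \<bullet> (L *v y) = \<phi> x \<bullet> \<phi> y" for x y
  proof -
    have "(L *v x) \<bullet> (L *v y) = ((norm (L *v (x + y)))\<^sup>2 - (norm (L *v x))\<^sup>2 - (norm (L *v y))\<^sup>2) / 2"
      by (simp add: dot_norm matrix_vector_right_distrib)
    also have "\<dots> = ((norm (\<phi> (x + y)))\<^sup>2 - (norm (\<phi> x))\<^sup>2 - (norm (\<phi> y))\<^sup>2) / 2"
      by (simp only: L f_norm)
    also have "\<dots> = \<phi> x \<bullet> \<phi> y"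
      by (simp add: dot_norm linear_add[OF \<open>linear \<phi>\<close>])
    finally show ?thesis .
  qed
  have "transpose L ** L = S"
  proof (rule matrix_eq[THEN iffD2], intro allI)
    fix y
    have "z \<bullet> ((transpose L ** L) *v y) = (L *v z) \<bullet> (L *v y)" for z
      by (metis inner_commute inner_transpose_matrix_vector matrix_vector_mul_assoc)
    then have "\<forall>z. z \<bullet> ((transpose L ** L) *v y) = z \<bullet> (S *v y)"
      by (simp add: inner_L S)
    then show "(transpose L ** L) *v y = S *v y"
      by (simp only: vector_eq_ldot)
  qed
  moreover have "inj ((*v) L)"
    unfolding linear_injective_0[OF matrix_vector_mul_linear]
  proof (intro allI impI)
    fix x assume "L *v x = 0"
    then have "\<phi> x = \<phi> 0"
      using inner_L[of x x] linear_0[OF \<open>linear \<phi>\<close>] by simp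
    then show "x = 0"
      using injD[OF \<open>inj \<phi>\<close>] by blast
  qed
  ultimately show ?thesis
    unfolding pos_definite_def using det_nz_iff_inj[of "(*v) L"] invertible_det_nz by force
qed

lemma pos_definite_covariance:
  fixes B :: "real^'r^'n"
  assumes "0 < c"
  shows "pos_definite (B ** transpose B + mat c)"
proof (rule pos_definite_gram)
  let ?\<phi> = "\<lambda>x. (transpose B *v x, sqrt c *\<^sub>R x)"
  show "linear ?\<phi>"
    by (intro linearI)
      (auto simp del: transpose_matrix_vector
        simp: matrix_vector_right_distrib matrix_vector_mult_scaleR scaleR_add_right)
  show "inj ?\<phi>"
    using assms by (auto simp: inj_def)
  show "x \<bullet> ((B ** transpose B + mat c) *v y) = ?\<phi> x \<bullet> ?\<phi> y" for x y
    using assms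
    by (simp add: inner_Pair matrix_vector_mult_add_rdistrib inner_add_right matrix_vector_mult_mat
        flip: matrix_vector_mul_assoc inner_transpose_matrix_vector)
qed

lemma borel_measurable_quadratic_form [measurable]:
  "(\<lambda>x::real^'n. x \<bullet> (M *v x)) \<in> borel_measurable borel"
  by (intro borel_measurable_continuous_onI continuous_intros linear_continuous_on
      matrix_vector_mul_bounded_linear)

lemma nn_integral_exp_norm_square:
  "(\<integral>\<^sup>+y. exp (- (norm (y::real^'n))\<^sup>2 / 2) \<partial>lborel) = sqrt (2 * pi) ^ CARD('n)"
proof -
  let ?c = "sqrt (2 * pi) ^ CARD('n)"
  have "exp (- (norm y)\<^sup>2 / 2) = ?c * (\<Prod>b\<in>Basis. std_normal_density (y \<bullet> b))"
    for y :: "real^'n"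
  proof -
    have "(\<Prod>b\<in>Basis. std_normal_density (y \<bullet> b))
        = (1 / sqrt (2 * pi)) ^ CARD('n) * exp (\<Sum>b\<in>Basis. - (y \<bullet> b)\<^sup>2 / 2)"
      by (simp add: std_normal_density_def prod.distrib exp_sum prod_dividef power_one_over)
    also have "(norm y)\<^sup>2 = (\<Sum>b\<in>Basis. (y \<bullet> b)\<^sup>2)"
      by (metis (no_types, lifting) power2_norm_eq_inner euclidean_inner power2_eq_square sum.cong)
    then have "(\<Sum>b\<in>Basis. - (y \<bullet> b)\<^sup>2 / 2) = - (norm y)\<^sup>2 / 2"
      by (simp add: sum_negf flip: sum_divide_distrib)
    finally show ?thesis
      by (simp add: power_one_over)
  qed
  then have "(\<integral>\<^sup>+y. exp (- (norm (y::real^'n))\<^sup>2 / 2) \<partial>lborel)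
      = (\<integral>\<^sup>+y. ?c * (\<Prod>b\<in>Basis. ennreal (std_normal_density (y \<bullet> b))) \<partial>(lborel :: (real^'n) measure))"
    by (simp add: ennreal_mult prod_ennreal normal_density_nonneg prod_nonneg)
  also have "\<dots> = ?c * (\<integral>\<^sup>+y. (\<Prod>b\<in>Basis. ennreal (std_normal_density (y \<bullet> b))) \<partial>(lborel :: (real^'n) measure))"
    by (rule nn_integral_cmult) measurable
  also have "(\<integral>\<^sup>+y. (\<Prod>b\<in>Basis. ennreal (std_normal_density (y \<bullet> b))) \<partial>(lborel :: (real^'n) measure)) = 1"
    by (subst nn_integral_lborel_prod)
      (auto simp: nn_integral_eq_integral normal_density_nonneg)
  finally show ?thesis
    by simp
qed

lemma gram_matrix_inv_quadratic_form:
  fixes L :: "real^'n^'n"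
  assumes "invertible L"
  shows "(transpose L *v y) \<bullet> (matrix_inv (transpose L ** L) *v (transpose L *v y)) = y \<bullet> y"
proof -
  let ?S = "transpose L ** L"
  have "invertible ?S"
    using assms by (simp add: invertible_det_nz det_mul)
  have "?S *v (matrix_inv L *v y) = transpose L *v y"
    by (simp add: matrix_inv_vector(1)[OF assms] flip: matrix_vector_mul_assoc)
  then have "matrix_inv ?S *v (transpose L *v y) = matrix_inv L *v y"
    by (metis matrix_inv_vector(2)[OF \<open>invertible ?S\<close>])
  then show ?thesis
    by (simp add: dot_lmul_matrix matrix_inv_vector(1)[OF assms])
qed

lemma nn_integral_gaussian_kernel:
  fixes S :: "real^'n^'n"
  assumes "pos_definite S"
  shows "(\<integral>\<^sup>+x. exp (- (x \<bullet> (matrix_inv S *v x)) / 2) \<partial>lborel)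
       = sqrt (2 * pi) ^ CARD('n) * sqrt (det S)"
proof -
  obtain L :: "real^'n^'n" where "invertible L" and S: "S = transpose L ** L"
    using assms unfolding pos_definite_def by blast
  then have "det (transpose L) \<noteq> 0" and "sqrt (det S) = \<bar>det (transpose L)\<bar>"
    by (simp_all add: invertible_det_nz det_mul)
  \<comment> \<open>substitute \<open>x = L\<^sup>T y\<close>\<close>
  then have "(\<integral>\<^sup>+x. exp (- (x \<bullet> (matrix_inv S *v x)) / 2) \<partial>lborel)
      = sqrt (det S) * (\<integral>\<^sup>+y. exp (- (norm (y::real^'n))\<^sup>2 / 2) \<partial>lborel)"
    by (subst nn_integral_lborel_linear[of "transpose L"])
      (simp_all add: S gram_matrix_inv_quadratic_form \<open>invertible L\<close> power2_norm_eq_inner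
        del: transpose_matrix_vector)
  also have "\<dots> = sqrt (2 * pi) ^ CARD('n) * sqrt (det S)"
    using pos_definite_det_pos[OF assms]
    by (subst nn_integral_exp_norm_square) (simp add: ennreal_mult mult.commute)
  finally show ?thesis .
qed

lemma gauss_density_eq:
  fixes S :: "real^'n^'n"
  assumes "0 < det S"
  shows "gauss_density S x
       = exp (- (x \<bullet> (matrix_inv S *v x)) / 2) / (sqrt (2 * pi) ^ CARD('n) * sqrt (det S))"
proof -
  have "(2 * pi) powr (- real CARD('n) / 2) = 1 / sqrt (2 * pi) ^ CARD('n)"
    by (simp add: powr_minus_divide powr_half_sqrt[symmetric] powr_powr powr_realpow[symmetric])
  moreover have "det S powr (- 1 / 2) = 1 / sqrt (det S)"
    using assms by (simp add: powr_minus_divide powr_half_sqrt)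
  ultimately show ?thesis
    by (simp add: gauss_density_def)
qed

lemma gauss_density_nonneg: "0 \<le> gauss_density S x"
  by (simp add: gauss_density_def)

lemma borel_measurable_gauss_density [measurable]: "gauss_density S \<in> borel_measurable borel"
  unfolding gauss_density_def[abs_def] by measurable

lemma nn_integral_gauss_density:
  fixes S :: "real^'n^'n"
  assumes "pos_definite S"
  shows "(\<integral>\<^sup>+x. gauss_density S x \<partial>lborel) = 1"
proof -
  let ?Z = "sqrt (2 * pi) ^ CARD('n) * sqrt (det S)"
  have "0 < ?Z"
    using pos_definite_det_pos[OF assms] by simp
  have "(\<integral>\<^sup>+x. gauss_density S x \<partial>lborel)
      = (\<integral>\<^sup>+x. ennreal (1 / ?Z) * ennreal (exp (- (x \<bullet> (matrix_inv S *v x)) / 2)) \<partial>lborel)"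
    using \<open>0 < ?Z\<close> pos_definite_det_pos[OF assms]
    by (simp add: gauss_density_eq flip: ennreal_mult)
  also have "\<dots> = ennreal (1 / ?Z) * ennreal ?Z"
    using nn_integral_gaussian_kernel[OF assms] by (subst nn_integral_cmult) simp_all
  also have "\<dots> = 1"
    using pos_definite_det_pos[OF assms] by (simp flip: ennreal_mult)
  finally show ?thesis .
qed

section \<open>The Loewner order\<close>

definition loewner_le :: "real^'n^'n \<Rightarrow> real^'n^'n \<Rightarrow> bool" where
  "loewner_le S T \<longleftrightarrow> (\<forall>y. y \<bullet> (S *v y) \<le> y \<bullet> (T *v y))"

lemma loewner_le_matrix_inv:
  fixes S T :: "real^'n^'n"
  assumes S: "pos_definite S" and T: "pos_definite T" and "loewner_le S T"
  shows "loewner_le (matrix_inv T) (matrix_inv S)"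
  unfolding loewner_le_def
proof
  fix x
  define v where "v = matrix_inv S *v x"
  define w where "w = matrix_inv T *v x"
  have Sv: "S *v v = x" and Tw: "T *v w = x"
    by (simp_all add: v_def w_def matrix_inv_vector pos_definite_invertible S T)
  \<comment> \<open>expand \<open>0 \<le> (w - v)\<^sup>T S (w - v)\<close> and use \<open>w\<^sup>T S w \<le> w\<^sup>T T w = w\<^sup>T x\<close>\<close>
  have "v \<bullet> (S *v w) = w \<bullet> x"
    using inner_transpose_matrix_vector[of S v w] pos_definite_symmetric[OF S]
    by (simp add: Sv inner_commute)
  then have "0 \<le> w \<bullet> (S *v w) - 2 * (w \<bullet> x) + v \<bullet> x"
    using pos_definite_nonneg[OF S, of "w - v"]
    by (simp add: matrix_vector_mult_diff_distrib inner_diff_left inner_diff_right Sv inner_commute)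
  moreover have "w \<bullet> (S *v w) \<le> w \<bullet> x"
    using \<open>loewner_le S T\<close> Tw by (auto simp: loewner_le_def)
  ultimately show "x \<bullet> (matrix_inv T *v x) \<le> x \<bullet> (matrix_inv S *v x)"
    by (simp add: v_def w_def inner_commute)
qed

text \<open>Monotonicity of the determinant, read off from the Gaussian normalising constants.\<close>

lemma det_mono_loewner:
  fixes S T :: "real^'n^'n"
  assumes S: "pos_definite S" and T: "pos_definite T" and "loewner_le S T"
  shows "det S \<le> det T"
proof -
  have "(\<integral>\<^sup>+x. exp (- (x \<bullet> (matrix_inv S *v x)) / 2) \<partial>lborel)
      \<le> (\<integral>\<^sup>+x. exp (- (x \<bullet> (matrix_inv T *v x)) / 2) \<partial>lborel)"
    using loewner_le_matrix_inv[OF S T \<open>loewner_le S T\<close>]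
    by (intro nn_integral_mono ennreal_leI) (simp add: loewner_le_def)
  then have "sqrt (2 * pi) ^ CARD('n) * sqrt (det S) \<le> sqrt (2 * pi) ^ CARD('n) * sqrt (det T)"
    using nn_integral_gaussian_kernel[OF S] nn_integral_gaussian_kernel[OF T]
      pos_definite_det_pos[OF T]
    by (simp add: ennreal_le_iff)
  then show ?thesis
    by simp
qed

lemma gauss_density_le_scaled:
  fixes S T :: "real^'n^'n"
  assumes S: "pos_definite S" and T: "pos_definite T" and "0 < a"
    and "loewner_le S T" and "loewner_le T (a *\<^sub>R S)"
  shows "gauss_density S x \<le> sqrt a ^ CARD('n) * gauss_density T x"
proof -
  have "det T \<le> a ^ CARD('n) * det S"
    using det_mono_loewner[OF T pos_definite_scaleR[OF S \<open>0 < a\<close>] \<open>loewner_le T _\<close>]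
    by (simp add: det_scaleR_cart)
  then have "sqrt (det T) \<le> sqrt a ^ CARD('n) * sqrt (det S)"
    using \<open>0 < a\<close> by (metis real_sqrt_le_mono real_sqrt_mult real_sqrt_power)
  moreover have "x \<bullet> (matrix_inv T *v x) \<le> x \<bullet> (matrix_inv S *v x)"
    using loewner_le_matrix_inv[OF S T \<open>loewner_le S T\<close>] by (simp add: loewner_le_def)
  moreover have "0 < det T"
    by (rule pos_definite_det_pos[OF T])
  ultimately have "exp (- (x \<bullet> (matrix_inv S *v x)) / 2) * sqrt (det T)
      \<le> exp (- (x \<bullet> (matrix_inv T *v x)) / 2) * (sqrt a ^ CARD('n) * sqrt (det S))"
    by (simp add: mult_mono)
  then show ?thesis
    using pos_definite_det_pos[OF S] pos_definite_det_pos[OF T]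
    by (simp add: gauss_density_eq field_simps)
qed

lemma nn_integral_diff_of_densities:
  fixes p q :: "'a \<Rightarrow> real"
  assumes [measurable]: "p \<in> borel_measurable M" "q \<in> borel_measurable M"
    and "\<And>x. 0 \<le> p x" and "0 \<le> c" and "\<And>x. p x \<le> c * q x"
    and "(\<integral>\<^sup>+x. p x \<partial>M) = 1" and "(\<integral>\<^sup>+x. q x \<partial>M) = 1"
  shows "(\<integral>\<^sup>+x. ennreal (c * q x - p x) \<partial>M) = ennreal (c - 1)"
proof -
  have "(\<integral>\<^sup>+x. ennreal (c * q x - p x) \<partial>M) = (\<integral>\<^sup>+x. ennreal (c * q x) - ennreal (p x) \<partial>M)"
    using assms(3) by (simp add: ennreal_minus)
  also have "\<dots> = (\<integral>\<^sup>+x. ennreal c * ennreal (q x) \<partial>M) - (\<integral>\<^sup>+x. p x \<partial>M)"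
    using assms(3-6)
    by (subst nn_integral_diff) (auto simp: ennreal_mult'[symmetric] intro: ennreal_leI)
  also have "\<dots> = ennreal (c - 1)"
    using assms(4,6,7) by (simp add: nn_integral_cmult) (metis ennreal_1 ennreal_minus zero_le_one)
  finally show ?thesis .
qed

section \<open>Perturbing the factor \<open>B\<close>\<close>

lemma inner_covariance:
  fixes B :: "real^'r^'n"
  shows "y \<bullet> ((B ** transpose B + mat c) *v y) = (norm (transpose B *v y))\<^sup>2 + c * (norm y)\<^sup>2"
  using inner_transpose_matrix_vector[of B y "transpose B *v y"]
  by (simp add: matrix_vector_mult_add_rdistrib inner_add_right matrix_vector_mult_mat
      power2_norm_eq_inner inner_commute flip: matrix_vector_mul_assoc)

lemma abs_matrix_entry_le_onorm: "\<bar>B $ i $ j\<bar> \<le> onorm (\<lambda>x. B *v x)"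
  for B :: "real^'m^'n"
proof -
  have "\<bar>B $ i $ j\<bar> = \<bar>(B *v axis j 1) $ i\<bar>"
    by (simp add: matrix_vector_mult_def axis_def if_distrib[of "\<lambda>a. _ * a"] cong: if_cong)
  also have "\<dots> \<le> norm (B *v axis j 1)"
    by (rule component_le_norm_cart)
  also have "\<dots> \<le> onorm (\<lambda>x. B *v x)"
    using onorm[OF matrix_vector_mul_bounded_linear, of B "axis j 1"] by simp
  finally show ?thesis .
qed

lemma norm_transpose_matrix_vector_le_onorm:
  "norm (transpose B *v y) \<le> onorm (\<lambda>x. B *v x) * norm y"
  for B :: "real^'m^'n"
proof -
  let ?v = "transpose B *v y"
  have "(norm ?v)\<^sup>2 = y \<bullet> (B *v ?v)"
    using inner_transpose_matrix_vector[of B y ?v] by (simp add: power2_norm_eq_inner inner_commute)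
  also have "\<dots> \<le> norm y * (onorm (\<lambda>x. B *v x) * norm ?v)"
    using norm_cauchy_schwarz[of y "B *v ?v"] onorm[OF matrix_vector_mul_bounded_linear, of B ?v]
    by (meson mult_left_mono norm_ge_zero order_trans)
  finally show ?thesis
    using onorm_pos_le[OF matrix_vector_mul_bounded_linear, of B]
    by (cases "?v = 0") (auto simp: power2_eq_square mult_ac)
qed

lemma norm_transpose_matrix_vector_le_entries:
  fixes M :: "real^'m^'n"
  assumes "\<And>i j. \<bar>M $ i $ j\<bar> \<le> h"
  shows "norm (transpose M *v y) \<le> real CARD('m) * real CARD('n) * h * norm y"
proof -
  have "\<bar>(transpose M *v y) $ j\<bar> \<le> real CARD('n) * (h * norm y)" for j
  proof -
    have "\<bar>(transpose M *v y) $ j\<bar> \<le> (\<Sum>i\<in>UNIV. \<bar>M $ i $ j\<bar> * \<bar>y $ i\<bar>)"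
      by (simp add: matrix_vector_mult_def transpose_def abs_mult[symmetric] sum_abs)
    also have "\<dots> \<le> (\<Sum>i\<in>(UNIV::'n set). h * norm y)"
      by (intro sum_mono mult_mono assms component_le_norm_cart) (auto intro: order_trans[OF _ assms])
    finally show ?thesis
      by simp
  qed
  then have "(\<Sum>j\<in>UNIV. \<bar>(transpose M *v y) $ j\<bar>) \<le> (\<Sum>j\<in>(UNIV::'m set). real CARD('n) * (h * norm y))"
    by (intro sum_mono)
  then show ?thesis
    using norm_le_l1_cart[of "transpose M *v y"] by (simp add: mult_ac)
qed

lemma square_le_perturbed_square:
  fixes a b t D \<delta> \<theta> :: real
  assumes "0 \<le> a" "0 \<le> t" "\<bar>a - b\<bar> \<le> \<delta> * t" "b \<le> (D + \<delta>) * t"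
    and "0 \<le> \<delta>" "\<delta> \<le> 1" "\<delta> * (2 * D + 3) \<le> \<theta>"
  shows "a\<^sup>2 \<le> b\<^sup>2 + \<theta> * t\<^sup>2"
proof -
  have "0 \<le> \<delta> * t"
    using assms(2,5) by simp
  have "\<delta> * \<delta> \<le> \<delta>"
    using assms(5,6) by (simp add: mult_left_le)
  have "a\<^sup>2 \<le> (b + \<delta> * t)\<^sup>2"
    using assms(1,3) by (intro power_mono) auto
  also have "\<dots> = b\<^sup>2 + 2 * (\<delta> * t) * b + (\<delta> * \<delta>) * t\<^sup>2"
    by (simp add: power2_eq_square algebra_simps)
  also have "\<dots> \<le> b\<^sup>2 + 2 * (\<delta> * t) * ((D + \<delta>) * t) + \<delta> * t\<^sup>2"
    using \<open>0 \<le> \<delta> * t\<close> \<open>\<delta> * \<delta> \<le> \<delta>\<close> assms(4)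
    by (simp add: add_mono mult_left_mono mult_right_mono)
  also have "\<dots> = b\<^sup>2 + (\<delta> * (2 * D + 3) - 2 * (\<delta> - \<delta> * \<delta>)) * t\<^sup>2"
    by (simp add: power2_eq_square algebra_simps)
  also have "\<dots> \<le> b\<^sup>2 + \<theta> * t\<^sup>2"
    using assms(7) \<open>\<delta> * \<delta> \<le> \<delta>\<close> by (simp add: mult_right_mono)
  finally show ?thesis .
qed

lemma covariance_loewner_sandwich:
  fixes B B0 :: "real^'r^'n"
  assumes "onorm (\<lambda>x. B *v x) \<le> D"
    and close: "\<And>y. norm (transpose (B - B0) *v y) \<le> \<delta> * norm y"
    and "0 \<le> \<delta>" "\<delta> \<le> 1" "\<delta> * (2 * D + 3) \<le> \<theta>"
  shows "loewner_le (B ** transpose B + mat 1) (B0 ** transpose B0 + mat (1 + \<theta>))"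
    and "loewner_le (B0 ** transpose B0 + mat (1 + \<theta>)) ((1 + 2 * \<theta>) *\<^sub>R (B ** transpose B + mat 1))"
proof -
  have "0 \<le> D"
    using assms(1) onorm_pos_le[OF matrix_vector_mul_bounded_linear, of B] by linarith
  then have "0 \<le> \<theta>"
    using assms(3,5) by (smt (verit) mult_nonneg_nonneg)
  have "a\<^sup>2 + t\<^sup>2 \<le> b\<^sup>2 + (1 + \<theta>) * t\<^sup>2 \<and> b\<^sup>2 + (1 + \<theta>) * t\<^sup>2 \<le> (1 + 2 * \<theta>) * (a\<^sup>2 + t\<^sup>2)"
    if "a = norm (transpose B *v y)" "b = norm (transpose B0 *v y)" "t = norm y" for a b t y
  proof -
    have "transpose (B - B0) *v y = transpose B *v y - transpose B0 *v y"
      by (simp add: vec_eq_iff transpose_def matrix_vector_mult_def algebra_simps sum_subtractf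
          del: transpose_matrix_vector)
    then have "\<bar>a - b\<bar> \<le> \<delta> * t" "\<bar>b - a\<bar> \<le> \<delta> * t"
      using close[of y] norm_triangle_ineq3[of "transpose B *v y" "transpose B0 *v y"] that
      by (simp_all add: abs_minus_commute)
    moreover have "a \<le> D * t"
      using norm_transpose_matrix_vector_le_onorm[of B y] assms(1) that
      by (simp add: mult_right_mono order_trans)
    ultimately have "a \<le> (D + \<delta>) * t" "b \<le> (D + \<delta>) * t"
      by (simp_all add: algebra_simps)
    then have "a\<^sup>2 \<le> b\<^sup>2 + \<theta> * t\<^sup>2" "b\<^sup>2 \<le> a\<^sup>2 + \<theta> * t\<^sup>2"
      using square_le_perturbed_square[of _ t _ \<delta> D \<theta>] \<open>\<bar>a - b\<bar> \<le> _\<close> \<open>\<bar>b - a\<bar> \<le> _\<close> assms(3-5) that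
      by auto
    moreover have "0 \<le> \<theta> * a\<^sup>2"
      using \<open>0 \<le> \<theta>\<close> by simp
    ultimately show ?thesis
      by (simp add: algebra_simps)
  qed
  then show "loewner_le (B ** transpose B + mat 1) (B0 ** transpose B0 + mat (1 + \<theta>))"
    and "loewner_le (B0 ** transpose B0 + mat (1 + \<theta>)) ((1 + 2 * \<theta>) *\<^sub>R (B ** transpose B + mat 1))"
    by (simp_all add: loewner_le_def inner_covariance scaleR_matrix_vector_assoc[symmetric])
qed

lemma gauss_density_bracket:
  fixes B B0 :: "real^'r^'n"
  assumes "onorm (\<lambda>x. B *v x) \<le> D"
    and "\<And>y. norm (transpose (B - B0) *v y) \<le> \<delta> * norm y"
    and "0 \<le> \<delta>" "\<delta> \<le> 1" "\<delta> * (2 * D + 3) \<le> \<theta>"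
  defines "q \<equiv> \<lambda>x. sqrt (1 + 2 * \<theta>) ^ CARD('n) * gauss_density (B0 ** transpose B0 + mat (1 + \<theta>)) x"
  shows "gauss_density (B ** transpose B + mat 1) x \<le> q x"
    and "(\<integral>\<^sup>+x. ennreal (q x - gauss_density (B ** transpose B + mat 1) x) \<partial>lborel)
       = ennreal (sqrt (1 + 2 * \<theta>) ^ CARD('n) - 1)"
proof -
  have "0 \<le> D"
    using assms(1) onorm_pos_le[OF matrix_vector_mul_bounded_linear, of B] by linarith
  then have "0 \<le> \<theta>"
    using assms(3,5) by (smt (verit) mult_nonneg_nonneg)
  have S: "pos_definite (B ** transpose B + mat 1)"
    and T: "pos_definite (B0 ** transpose B0 + mat (1 + \<theta>))"
    using \<open>0 \<le> \<theta>\<close> by (simp_all add: pos_definite_covariance)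
  note sandwich = covariance_loewner_sandwich[OF assms(1-5)]
  show le: "gauss_density (B ** transpose B + mat 1) x \<le> q x" for x
    unfolding q_def using \<open>0 \<le> \<theta>\<close> by (intro gauss_density_le_scaled[OF S T _ sandwich]) auto
  show "(\<integral>\<^sup>+x. ennreal (q x - gauss_density (B ** transpose B + mat 1) x) \<partial>lborel)
       = ennreal (sqrt (1 + 2 * \<theta>) ^ CARD('n) - 1)"
    using le \<open>0 \<le> \<theta>\<close> unfolding q_def
    by (intro nn_integral_diff_of_densities)
      (auto simp: gauss_density_nonneg nn_integral_gauss_density S T)
qed

section \<open>Grids and counting\<close>

lemma matrix_grid_approx:
  fixes D h :: real
  assumes "0 < h" "0 \<le> D"
  obtains G :: "(real^'m^'n) set" where "finite G"
    and "real (card G) \<le> (2 * D / h + 2) ^ (CARD('n) * CARD('m))"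
    and "\<And>B. (\<And>i j. \<bar>B $ i $ j\<bar> \<le> D) \<Longrightarrow> \<exists>B0\<in>G. \<forall>i j. \<bar>(B - B0) $ i $ j\<bar> \<le> h"
proof
  define Z where "Z = {\<lfloor>- D / h\<rfloor> .. \<lfloor>D / h\<rfloor>}"
  define K where "K = (UNIV :: ('n \<times> 'm) set) \<rightarrow>\<^sub>E Z"
  define grid where "grid k = (\<chi> i j. h * of_int (k (i, j)) :: real^'m^'n)" for k
  have "finite K"
    by (simp add: K_def Z_def finite_PiE)
  then show "finite (grid ` K)"
    by simp
  have "real (card Z) \<le> 2 * D / h + 2"
  proof -
    have "real_of_int \<lfloor>D / h\<rfloor> \<le> D / h" "- D / h < real_of_int \<lfloor>- D / h\<rfloor> + 1"
      by (rule of_int_floor_le, rule real_of_int_floor_add_one_gt)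
    moreover have "2 * D / h = D / h - (- D / h)"
      by simp
    ultimately have "real_of_int \<lfloor>D / h\<rfloor> - real_of_int \<lfloor>- D / h\<rfloor> + 1 \<le> 2 * D / h + 2"
      by linarith
    moreover have "\<lfloor>- D / h\<rfloor> \<le> \<lfloor>D / h\<rfloor>"
      using assms by (intro floor_mono) (simp add: divide_right_mono)
    ultimately show ?thesis
      by (simp add: Z_def)
  qed
  have "card K = card Z ^ (CARD('n) * CARD('m))"
    by (simp add: K_def card_PiE card_cartesian_product flip: UNIV_Times_UNIV)
  then show "real (card (grid ` K)) \<le> (2 * D / h + 2) ^ (CARD('n) * CARD('m))"
    using card_image_le[OF \<open>finite K\<close>, of grid] \<open>real (card Z) \<le> _\<close>
    by (smt (verit, best) of_nat_0_le_iff of_nat_le_iff of_nat_power power_mono)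
  fix B :: "real^'m^'n"
  assume B: "\<And>i j. \<bar>B $ i $ j\<bar> \<le> D"
  define k where "k = (\<lambda>(i, j). \<lfloor>B $ i $ j / h\<rfloor>)"
  have "- D \<le> B $ i $ j" "B $ i $ j \<le> D" for i j
    using B[of i j] by auto
  then have "\<lfloor>- D / h\<rfloor> \<le> \<lfloor>B $ i $ j / h\<rfloor> \<and> \<lfloor>B $ i $ j / h\<rfloor> \<le> \<lfloor>D / h\<rfloor>" for i j
    using assms(1) divide_right_mono[of "- D" "B $ i $ j" h]
    by (auto intro!: floor_mono divide_right_mono)
  then have "k \<in> K"
    by (auto simp: K_def Z_def k_def)
  moreover have "\<bar>(B - grid k) $ i $ j\<bar> \<le> h" for i j
    using assms(1) floor_divide_lower[of h "B $ i $ j"] floor_divide_upper[of h "B $ i $ j"]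
    by (simp add: grid_def k_def abs_le_iff algebra_simps)
  ultimately show "\<exists>B0\<in>grid ` K. \<forall>i j. \<bar>(B - B0) $ i $ j\<bar> \<le> h"
    by blast
qed

lemma operator_norm_grid_approx:
  fixes D \<delta> :: real
  assumes "0 < \<delta>" "0 \<le> D"
  obtains G :: "(real^'m^'n) set" where "finite G"
    and "real (card G) \<le> (2 * D * CARD('m) * CARD('n) / \<delta> + 2) ^ (CARD('n) * CARD('m))"
    and "\<And>B. onorm (\<lambda>x. B *v x) \<le> D
      \<Longrightarrow> \<exists>B0\<in>G. \<forall>y. norm (transpose (B - B0) *v y) \<le> \<delta> * norm y"
proof -
  define h where "h = \<delta> / (CARD('m) * CARD('n))"
  have "0 < h"
    using assms(1) by (simp add: h_def)
  obtain G :: "(real^'m^'n) set" where "finite G"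
    and card_G: "card G \<le> (2 * D / h + 2) ^ (CARD('n) * CARD('m))"
    and grid: "\<And>B. (\<And>i j. \<bar>B $ i $ j\<bar> \<le> D) \<Longrightarrow> \<exists>B0\<in>G. \<forall>i j. \<bar>(B - B0) $ i $ j\<bar> \<le> h"
    using matrix_grid_approx[where 'm = 'm and 'n = 'n, OF \<open>0 < h\<close> assms(2)] by blast
  moreover have "\<exists>B0\<in>G. \<forall>y. norm (transpose (B - B0) *v y) \<le> \<delta> * norm y"
    if "onorm (\<lambda>x. B *v x) \<le> D" for B
  proof -
    have "\<bar>B $ i $ j\<bar> \<le> D" for i j
      using abs_matrix_entry_le_onorm[of B i j] that by linarith
    then obtain B0 where "B0 \<in> G" and "\<And>i j. \<bar>(B - B0) $ i $ j\<bar> \<le> h"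
      using grid by blast
    then have "norm (transpose (B - B0) *v y) \<le> \<delta> * norm y" for y
      using norm_transpose_matrix_vector_le_entries[of "B - B0" h y] by (simp add: h_def)
    then show ?thesis
      using \<open>B0 \<in> G\<close> by blast
  qed
  moreover have "2 * D / h = 2 * D * CARD('m) * CARD('n) / \<delta>"
    by (simp add: h_def)
  ultimately show ?thesis
    using that by simp
qed

lemma is_bracketing_gauss_family:
  fixes G :: "(real^'r^'n) set"
  assumes "finite G"
    and approx: "\<And>B. onorm (\<lambda>x. B *v x) \<le> D
      \<Longrightarrow> \<exists>B0\<in>G. \<forall>y. norm (transpose (B - B0) *v y) \<le> \<delta> * norm y"
    and "0 \<le> \<delta>" "\<delta> \<le> 1" "\<delta> * (2 * D + 3) \<le> \<theta>" "0 \<le> \<theta>"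
    and "sqrt (1 + 2 * \<theta>) ^ CARD('n) - 1 \<le> \<epsilon>"
  shows "is_bracketing (gauss_family {B :: real^'r^'n. onorm (\<lambda>x. B *v x) \<le> D}) \<epsilon>
    ((\<lambda>B0 x. sqrt (1 + 2 * \<theta>) ^ CARD('n) * gauss_density (B0 ** transpose B0 + mat (1 + \<theta>)) x) ` G)"
  unfolding is_bracketing_def
proof (intro conjI ballI)
  fix p assume "p \<in> gauss_family {B :: real^'r^'n. onorm (\<lambda>x. B *v x) \<le> D}"
  then obtain B :: "real^'r^'n" where B: "onorm (\<lambda>x. B *v x) \<le> D"
    and p: "p = gauss_density (B ** transpose B + mat 1)"
    unfolding gauss_family_def by blast
  obtain B0 where "B0 \<in> G" and "\<And>y. norm (transpose (B - B0) *v y) \<le> \<delta> * norm y"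
    using approx[OF B] by blast
  note bracket = gauss_density_bracket[OF B this(2) assms(3-5)]
  show "\<exists>q\<in>(\<lambda>B0 x. sqrt (1 + 2 * \<theta>) ^ CARD('n) * gauss_density (B0 ** transpose B0 + mat (1 + \<theta>)) x) ` G.
      (\<forall>x. p x \<le> q x) \<and> (\<integral>\<^sup>+x. ennreal (q x - p x) \<partial>lborel) \<le> ennreal \<epsilon>"
    using \<open>B0 \<in> G\<close> bracket assms(7) unfolding p by (auto intro!: bexI[of _ B0] ennreal_leI)
qed (use assms(1,6) in \<open>auto simp: gauss_density_nonneg\<close>)

lemma sqrt_one_plus_inverse_power_le:
  fixes m :: real and d :: nat
  assumes "1 \<le> m" and "1 \<le> d"
  shows "sqrt (1 + 1 / (2 * m * d)) ^ d \<le> 1 + 1 / m"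
proof -
  define x where "x = 1 / (2 * m * d)"
  have "1 \<le> m * d"
    using assms mult_mono[of 1 m 1 "real d"] by simp
  then have "0 < x" "x \<le> 1" "d * x = 1 / (2 * m)"
    using assms by (simp_all add: x_def)
  have "(1 + x) ^ d * (1 - d * x) \<le> (1 + x) ^ d * (1 - x) ^ d"
    using Bernoulli_inequality[of "- x" d] \<open>0 < x\<close> \<open>x \<le> 1\<close> by (intro mult_left_mono) auto
  also have "\<dots> = (1 - x * x) ^ d"
    by (simp add: power_mult_distrib[symmetric] algebra_simps)
  also have "\<dots> \<le> 1"
    using \<open>0 < x\<close> \<open>x \<le> 1\<close> by (intro power_le_one) (auto simp: mult_le_one)
  finally have "(1 + x) ^ d * (1 - d * x) \<le> 1" .
  moreover have "0 < 1 - d * x"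
    using \<open>d * x = _\<close> assms(1) by simp
  ultimately have "(1 + x) ^ d \<le> 1 / (1 - d * x)"
    by (simp add: le_divide_eq)
  also have "\<dots> = 2 * m / (2 * m - 1)"
    unfolding \<open>d * x = 1 / (2 * m)\<close> using assms(1) by (simp add: field_simps)
  also have "\<dots> \<le> 1 + 1 / m"
    using assms(1) by (simp add: field_simps)
  finally have "(1 + x) ^ d \<le> 1 + 1 / m" .
  have "sqrt (1 + x) \<le> 1 + x"
    using \<open>0 < x\<close> mult_left_mono[of 1 "sqrt (1 + x)" "sqrt (1 + x)"] by simp
  then have "sqrt (1 + x) ^ d \<le> (1 + x) ^ d"
    by (rule power_mono) (use \<open>0 < x\<close> in simp)
  also have "\<dots> \<le> 1 + 1 / m"
    by fact
  finally show ?thesis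
    by (simp add: x_def)
qed

lemma grid_count_le:
  fixes m d r D :: real
  assumes "1 \<le> m" "1 \<le> d" "1 \<le> r" "0 \<le> D"
  shows "8 * m * d\<^sup>2 * r * D * (2 * D + 3) + 2 \<le> (24 * m * d * r * (D\<^sup>2 + 1)) ^ 4"
proof -
  define P where "P = m * d * r"
  define E where "E = D\<^sup>2 + 1"
  have "1 \<le> m * r"
    using assms mult_mono[of 1 m 1 r] by simp
  then have "d \<le> P"
    using assms(2) mult_left_mono[of 1 "m * r" d] by (simp add: P_def mult_ac)
  have "1 \<le> E"
    by (simp add: E_def)
  have "D * (2 * D + 3) \<le> 4 * E"
    using sum_power2_ge_zero[of "D - 3 / 4" 0] by (simp add: E_def power2_eq_square algebra_simps)
  have "8 * m * d\<^sup>2 * r * D * (2 * D + 3) = 8 * d * P * (D * (2 * D + 3))"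
    by (simp add: P_def power2_eq_square mult_ac)
  also have "\<dots> \<le> (8 * P * P) * (4 * E * E)"
  proof (rule mult_mono)
    show "8 * d * P \<le> 8 * P * P"
      using \<open>d \<le> P\<close> assms(2) by simp
    have "4 * E \<le> 4 * E * E"
      using \<open>1 \<le> E\<close> by simp
    then show "D * (2 * D + 3) \<le> 4 * E * E"
      using \<open>D * (2 * D + 3) \<le> 4 * E\<close> by linarith
  qed (use assms(4) in auto)
  also have "\<dots> = 32 * (P * E)\<^sup>2"
    by (simp add: power2_eq_square mult_ac)
  finally have "8 * m * d\<^sup>2 * r * D * (2 * D + 3) \<le> 32 * (P * E)\<^sup>2" .
  moreover have "1 \<le> P * E"
    using \<open>d \<le> P\<close> \<open>1 \<le> E\<close> assms(2) mult_mono[of 1 P 1 E] by simp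
  then have "1 \<le> (P * E)\<^sup>2" and "(P * E)\<^sup>2 \<le> (P * E) ^ 4"
    by (simp_all add: one_le_power power_increasing)
  ultimately have "8 * m * d\<^sup>2 * r * D * (2 * D + 3) + 2 \<le> 331776 * (P * E) ^ 4"
    by linarith
  also have "\<dots> = (24 * m * d * r * (D\<^sup>2 + 1)) ^ 4"
    unfolding P_def E_def power_mult_distrib by simp
  finally show ?thesis .
qed

lemma bracketing_number_le_card: "is_bracketing P \<epsilon> N \<Longrightarrow> bracketing_number P \<epsilon> \<le> enat (card N)"
  unfolding bracketing_number_def by (rule Inf_lower) auto

lemma gauss_family_bracketing:
  fixes D :: real and m :: nat
  assumes "0 < D" "1 \<le> m"
  obtains N where "is_bracketing (gauss_family {B :: real^'r^'n. onorm (\<lambda>x. B *v x) \<le> D}) (1 / m) N"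
    and "real (card N)
      \<le> (24 * real m * real CARD('n) * real CARD('r) * (D\<^sup>2 + 1)) ^ (4 * (CARD('n) * CARD('r)))"
proof -
  let ?d = "real CARD('n)" and ?r = "real CARD('r)"
  have "1 \<le> ?d" "1 \<le> ?r" "1 \<le> real m"
    using assms(2) by (simp_all add: Suc_le_eq)
  define \<theta> where "\<theta> = 1 / (4 * m * ?d)"
  define \<delta> where "\<delta> = \<theta> / (2 * D + 3)"
  have "1 \<le> m * ?d"
    using \<open>1 \<le> ?d\<close> \<open>1 \<le> real m\<close> mult_mono[of 1 "real m" 1 ?d] by simp
  then have "0 < \<theta>" "\<theta> \<le> 1"
    by (simp_all add: \<theta>_def)
  then have "0 < \<delta>" "\<delta> \<le> 1" "\<delta> * (2 * D + 3) \<le> \<theta>"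
    using assms(1) by (simp_all add: \<delta>_def field_simps)
  obtain G :: "(real^'r^'n) set" where "finite G"
    and card_G: "card G \<le> (2 * D * ?r * ?d / \<delta> + 2) ^ (CARD('n) * CARD('r))"
    and approx: "\<And>B. onorm (\<lambda>x. B *v x) \<le> D
      \<Longrightarrow> \<exists>B0\<in>G. \<forall>y. norm (transpose (B - B0) *v y) \<le> \<delta> * norm y"
    using operator_norm_grid_approx[OF \<open>0 < \<delta>\<close> less_imp_le[OF assms(1)]] by blast
  have eps: "sqrt (1 + 2 * \<theta>) ^ CARD('n) - 1 \<le> 1 / m"
    using sqrt_one_plus_inverse_power_le[of m "CARD('n)"] \<open>1 \<le> real m\<close>
    by (simp add: \<theta>_def mult.assoc)
  define q where "q B0 x = sqrt (1 + 2 * \<theta>) ^ CARD('n) * gauss_density (B0 ** transpose B0 + mat (1 + \<theta>)) x"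
    for B0 :: "real^'r^'n" and x
  have bracketing: "is_bracketing (gauss_family {B :: real^'r^'n. onorm (\<lambda>x. B *v x) \<le> D}) (1 / m) (q ` G)"
    unfolding q_def[abs_def]
    using \<open>finite G\<close> approx \<open>0 < \<delta>\<close> \<open>\<delta> \<le> 1\<close> \<open>\<delta> * (2 * D + 3) \<le> \<theta>\<close> \<open>0 < \<theta>\<close> eps
    by (intro is_bracketing_gauss_family) auto
  have "2 * D * ?r * ?d / \<delta> + 2 = 8 * real m * ?d\<^sup>2 * ?r * D * (2 * D + 3) + 2"
    using assms(1) \<open>1 \<le> ?d\<close> \<open>1 \<le> real m\<close> by (simp add: \<delta>_def \<theta>_def field_simps power2_eq_square)
  then have "2 * D * ?r * ?d / \<delta> + 2 \<le> (24 * real m * ?d * ?r * (D\<^sup>2 + 1)) ^ 4"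
    using grid_count_le[of m ?d ?r D] \<open>1 \<le> ?d\<close> \<open>1 \<le> ?r\<close> \<open>1 \<le> real m\<close> assms(1) by simp
  then have "(2 * D * ?r * ?d / \<delta> + 2) ^ (CARD('n) * CARD('r))
      \<le> ((24 * real m * ?d * ?r * (D\<^sup>2 + 1)) ^ 4) ^ (CARD('n) * CARD('r))"
    by (rule power_mono) (use \<open>0 < \<delta>\<close> assms(1) in simp)
  with card_G card_image_le[OF \<open>finite G\<close>, of q]
  have "real (card (q ` G)) \<le> (24 * real m * ?d * ?r * (D\<^sup>2 + 1)) ^ (4 * (CARD('n) * CARD('r)))"
    unfolding power_mult by linarith
  with bracketing show ?thesis
    by (rule that)
qed

theorem mainTheorem9:
  fixes D :: real and m :: nat
  assumes "CARD('r) < CARD('d)"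
    and "D > 0" and "m \<ge> 1"
  shows "bracketing_number (gauss_family {B :: real^'r^'d. onorm (\<lambda>x. B *v x) \<le> D}) (1 / real m) < \<infinity>
     \<and> ln (real (the_enat (bracketing_number
            (gauss_family {B :: real^'r^'d. onorm (\<lambda>x. B *v x) \<le> D}) (1 / real m))))
        \<le> 4 * real CARD('d) * real CARD('r)
            * ln (24 * real m * real CARD('d) * real CARD('r) * (D^2 + 1))"
proof -
  let ?P = "gauss_family {B :: real^'r^'d. onorm (\<lambda>x. B *v x) \<le> D}"
  let ?X = "24 * real m * real CARD('d) * real CARD('r) * (D^2 + 1)"
  obtain N where bracketing: "is_bracketing ?P (1 / m) N" and card_N: "real (card N) \<le> ?X ^ (4 * (CARD('d) * CARD('r)))"
    using gauss_family_bracketing[OF \<open>D > 0\<close> \<open>m \<ge> 1\<close>] by blast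
  have "bracketing_number ?P (1 / m) \<le> enat (card N)"
    using bracketing by (rule bracketing_number_le_card)
  then obtain n where n: "bracketing_number ?P (1 / m) = enat n" and "n \<le> card N"
    by (cases "bracketing_number ?P (1 / m)") auto
  have "1 \<le> ?X"
    using \<open>m \<ge> 1\<close> by (intro mult_ge1_I) (auto simp: Suc_le_eq)
  have "ln (real n) \<le> 4 * real CARD('d) * real CARD('r) * ln ?X"
  proof (cases "n = 0")
    case False
    then have "ln (real n) \<le> ln (?X ^ (4 * (CARD('d) * CARD('r))))"
      using \<open>n \<le> card N\<close> card_N by (simp add: order_trans)
    also have "\<dots> = 4 * real CARD('d) * real CARD('r) * ln ?X"
      using \<open>1 \<le> ?X\<close> by (simp add: ln_realpow)
    finally show ?thesis .
  qed (use \<open>1 \<le> ?X\<close> in simp)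
  then show ?thesis
    by (simp add: n)
qed

end
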